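(* Let $y$ be a real number and $\psi:\mathbb{Z}_{\ge1}\to[0,\infty)$. For an integer $m\ge1$ let $\mathcal{E}^{my}$ be the set of real $x$ for which there are infinitely many pairs of integers $(a,n)$ with $n\ge1$, $\gcd(a,n)=1$, and $|nx-a+my|<\psi(n)$. Then either $\mathcal{E}^{my}$ has Lebesgue measure zero for every integer $m\geq1$, or at least one of the following holds: (i) there is some integer $m\geq1$ such that $\mathcal{E}^{my}$ contains almost every real number; (ii) for every $\varepsilon>0$ there are infinitely many integers $m\geq1$ such that the measure of $\mathcal{E}^{my}$ is greater than $1-\varepsilon$.
   Context: Each set $\mathcal{E}^{my}$ is $1$-periodic; its measure means the Lebesgue measure of $\mathcal{E}^{my}\cap[0,1)$. *)

theory Defs
  imports "HOL-Analysis.Analysis"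
begin

definition inhom_approx_set :: "(nat \<Rightarrow> real) \<Rightarrow> real \<Rightarrow> real set" where
  "inhom_approx_set \<psi> z =
     {x. infinite {(a :: int, n :: nat).
           n \<ge> 1 \<and> coprime a (int n) \<and> \<bar>real n * x - real_of_int a + z\<bar> < \<psi> n}}"

definition unit_measure :: "real set \<Rightarrow> real" where
  "unit_measure S = measure lebesgue (S \<inter> {0..<1})"

text \<open>Measurability and periodicity: \<^const>\<open>unit_measure\<close> of an \<^const>\<open>inhom_approx_set\<close> is
  the genuine measure of one full period, never the default value of
  \<^const>\<open>measure\<close> on a non-measurable set.\<close>

lemma borel_inhom_approx_set [measurable]: "inhom_approx_set \<psi> z \<in> sets borel"
proof -
  define P where "P = (\<lambda>(x :: real) (p :: int \<times> nat). snd p \<ge> 1 \<and> coprime (fst p) (int (snd p))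
    \<and> \<bar>real (snd p) * x - real_of_int (fst p) + z\<bar> < \<psi> (snd p))"
  have meas: "{x. P x p} \<in> sets borel" for p
    unfolding P_def by measurable
  have "infinite {p. P x p} \<longleftrightarrow> (\<forall>k. \<exists>p. k \<le> to_nat p \<and> P x p)" for x
  proof -
    have "infinite {p. P x p} \<longleftrightarrow> infinite (to_nat ` {p. P x p})"
      by (simp add: finite_image_iff)
    also have "\<dots> \<longleftrightarrow> (\<forall>k. \<exists>i\<ge>k. i \<in> to_nat ` {p. P x p})"
      by (rule infinite_nat_iff_unbounded_le)
    also have "\<dots> \<longleftrightarrow> (\<forall>k. \<exists>p. k \<le> to_nat p \<and> P x p)"
      by blast
    finally show ?thesis .
  qed
  moreover have "inhom_approx_set \<psi> z = {x. infinite {p. P x p}}"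
    by (simp add: inhom_approx_set_def P_def case_prod_unfold)
  ultimately have "inhom_approx_set \<psi> z = (\<Inter>k. \<Union>p\<in>{p. k \<le> to_nat p}. {x. P x p})"
    by auto
  also have "\<dots> \<in> sets borel"
    using meas by (intro sets.countable_INT'' sets.countable_UN'') auto
  finally show ?thesis .
qed

lemma inhom_approx_set_periodic: "x + 1 \<in> inhom_approx_set \<psi> z \<longleftrightarrow> x \<in> inhom_approx_set \<psi> z"
proof -
  define A where "A = (\<lambda>x. {(a :: int, n :: nat).
    n \<ge> 1 \<and> coprime a (int n) \<and> \<bar>real n * x - real_of_int a + z\<bar> < \<psi> n})"
  define f where "f = (\<lambda>(a :: int, n :: nat). (a + int n, n))"
  have inj: "inj_on f S" for S
    by (auto simp: inj_on_def f_def)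
  have "A (x + 1) = f ` A x"
  proof (intro equalityI subsetI)
    fix p assume p: "p \<in> A (x + 1)"
    obtain a n where an: "p = (a, n)" by (cases p)
    have "coprime (a - int n) (int n)"
      using p an by (simp add: A_def coprime_iff_gcd_eq_1 gcd_diff1)
    then have "(a - int n, n) \<in> A x"
      using p an by (auto simp: A_def algebra_simps)
    moreover have "p = f (a - int n, n)"
      by (simp add: f_def an)
    ultimately show "p \<in> f ` A x" by blast
  next
    fix p assume "p \<in> f ` A x"
    then show "p \<in> A (x + 1)"
      by (auto simp: A_def f_def algebra_simps coprime_iff_gcd_eq_1)
  qed
  then have "infinite (A (x + 1)) \<longleftrightarrow> infinite (A x)"
    using inj by (simp add: finite_image_iff)
  then show ?thesis
    by (simp add: inhom_approx_set_def A_def)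
qed

end

theory Submission
  imports Defs
begin

text \<open>
  If \<open>\<psi> n / n\<close> does not tend to 0, the approximation sets are everything, because gaps between
  integers coprime to \<open>n\<close> have length \<open>o(n)\<close>. Otherwise the argument is that of Cassels and
  Gallagher. Suppose the set for the shift \<open>z = m y\<close> has positive measure, and for a prime \<open>p\<close> split the
  denominators \<open>n\<close> according to whether \<open>p\<close> does not divide \<open>n\<close>, divides it exactly once, or \<open>p\<^sup>2\<close>
  divides \<open>n\<close>. The maps \<open>x \<mapsto> p^k x\<close> and \<open>x \<mapsto> p^k x + 1/p\<close> send the first and the second
  part for \<open>z\<close> into the same part for \<open>p^k z\<close> with \<open>\<psi>\<close> enlarged by the factor \<open>p^k\<close>, which alters
  the limsup set only by a null set. If one of these parts has positive measure, expanding around a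
  density point gives measure close to 1 for all large \<open>k\<close>. If they are null for every \<open>p\<close>, the set
  agrees almost everywhere with its third part, which is \<open>1/p\<close>-periodic; periodicity with
  arbitrarily small periods forces full measure.
\<close>

section \<open>Density points and limsup sets of balls\<close>

text \<open>A weak Lebesgue density theorem. If it fails, each point of \<open>S\<close> is the
  centre of arbitrarily small balls that \<open>S\<close> fills to a proportion at most
  \<open>1 - \<delta>\<close>. A Vitali cover of a piece of finite measure by disjoint such balls,
  inside a barely larger open set, forces that piece to be null.\<close>

lemma exists_density_point:
  fixes S :: "'a::euclidean_space set"
  assumes S: "S \<in> sets lebesgue" and pos: "\<not> negligible S" and "\<delta> > 0"
  obtains x e where "x \<in> S" "e > 0"
    "\<And>r. 0 < r \<Longrightarrow> r < e \<Longrightarrow> (1 - \<delta>) * measure lebesgue (cball x r) < measure lebesgue (S \<inter> cball x r)"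
proof (rule ccontr)
  assume contr: "\<not> thesis"
  note point = that
  have sparse: "\<exists>r. 0 < r \<and> r < e \<and>
      measure lebesgue (S \<inter> cball x r) \<le> (1 - \<delta>) * measure lebesgue (cball x r)"
    if "x \<in> S" "e > 0" for x e
  proof (rule ccontr)
    assume no_r: "\<not> ?thesis"
    have thesis
    proof (rule point[OF \<open>x \<in> S\<close> \<open>e > 0\<close>])
      fix r assume "0 < r" "r < e"
      with no_r show "(1 - \<delta>) * measure lebesgue (cball x r) < measure lebesgue (S \<inter> cball x r)"
        using not_le by blast
    qed
    with contr show False by contradiction
  qed
  have bdd: "negligible T" if T: "T \<in> lmeasurable" "T \<subseteq> S" for T
  proof -
    \<comment> \<open>Since \<open>\<delta>\<close> may exceed 1, the proportion is cut off at 0 so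
      that it can pass through \<open>ennreal\<close>.\<close>
    define q where "q = max 0 (1 - \<delta>)"
    have q: "0 \<le> q" "q < 1" using \<open>\<delta> > 0\<close> by (auto simp: q_def)
    have le: "measure lebesgue T \<le> q * (measure lebesgue T + \<eta>)" if "\<eta> > 0" for \<eta>
    proof -
      obtain U where U: "open U" "T \<subseteq> U" "U - T \<in> lmeasurable" "emeasure lebesgue (U - T) < ennreal \<eta>"
        using sets_lebesgue_outer_open[of T \<eta>] T \<open>\<eta> > 0\<close> by (metis fmeasurableD)
      have "U = T \<union> (U - T)" using U by auto
      then have Um: "U \<in> lmeasurable" using T U by (metis fmeasurable.Un)
      have "measure lebesgue U \<le> measure lebesgue T + measure lebesgue (U - T)"
        using \<open>U = T \<union> (U - T)\<close> T U measure_Un_le[of T lebesgue "U - T"] by (auto dest: fmeasurableD)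
      moreover have "measure lebesgue (U - T) < \<eta>"
        using U \<open>\<eta> > 0\<close> by (simp add: emeasure_eq_measure2 ennreal_less_iff)
      ultimately have Ule: "measure lebesgue U \<le> measure lebesgue T + \<eta>" by simp
      \<comment> \<open>Balls are kept inside \<open>U\<close> so that disjoint ones have total
        measure at most that of \<open>U\<close>.\<close>
      define K where "K = {(x, r). 0 < r \<and> cball x r \<subseteq> U \<and>
        measure lebesgue (T \<inter> cball x r) \<le> q * measure lebesgue (cball x r)}"
      obtain C where C: "countable C" "C \<subseteq> K"
        "pairwise (\<lambda>i j. disjnt (cball (fst i) (snd i)) (cball (fst j) (snd j))) C"
        "negligible (T - (\<Union>i\<in>C. cball (fst i) (snd i)))"
      proof (rule Vitali_covering_theorem_cballs[of K snd T fst])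
        show "0 < snd i" if "i \<in> K" for i using that by (auto simp: K_def)
        show "\<exists>i. i \<in> K \<and> x \<in> cball (fst i) (snd i) \<and> snd i < d" if xd: "x \<in> T" "0 < d" for x d
        proof -
          obtain e where e: "e > 0" "cball x e \<subseteq> U"
            using U(1,2) xd(1) open_contains_cball[of U] by blast
          obtain r where r: "0 < r" "r < min d e"
            "measure lebesgue (S \<inter> cball x r) \<le> (1 - \<delta>) * measure lebesgue (cball x r)"
            using sparse[of x "min d e"] xd e T by auto
          have "measure lebesgue (T \<inter> cball x r) \<le> measure lebesgue (S \<inter> cball x r)"
            using T S
            by (intro measure_mono_fmeasurable fmeasurableI2[OF lmeasurable_cball[of x r]] sets.Int) auto
          also have "\<dots> \<le> (1 - \<delta>) * measure lebesgue (cball x r)" by (fact r)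
          also have "\<dots> \<le> q * measure lebesgue (cball x r)"
            by (intro mult_right_mono) (auto simp: q_def)
          finally have "(x, r) \<in> K" using r e by (auto simp: K_def)
          then show ?thesis using r by (intro exI[of _ "(x, r)"]) auto
        qed
      qed auto
      let ?B = "\<lambda>i::'a \<times> real. cball (fst i) (snd i)"
      have disj: "disjoint_family_on ?B C"
        using C(3) by (auto simp: disjoint_family_on_def pairwise_def disjnt_def)
      have "emeasure lebesgue T \<le> emeasure lebesgue ((T - (\<Union>i\<in>C. ?B i)) \<union> (\<Union>i\<in>C. T \<inter> ?B i))"
        using T C(1) by (intro emeasure_mono sets.Un sets.Diff sets.countable_UN') (auto simp: fmeasurableD)
      also have "\<dots> \<le> emeasure lebesgue (T - (\<Union>i\<in>C. ?B i)) + emeasure lebesgue (\<Union>i\<in>C. T \<inter> ?B i)"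
        using T C(1) by (intro emeasure_subadditive sets.Diff sets.countable_UN') (auto simp: fmeasurableD)
      also have "emeasure lebesgue (T - (\<Union>i\<in>C. ?B i)) = 0"
        using C(4) by (simp add: negligible_iff_null_sets null_setsD1)
      also have "emeasure lebesgue (\<Union>i\<in>C. T \<inter> ?B i) = (\<integral>\<^sup>+i. emeasure lebesgue (T \<inter> ?B i) \<partial>count_space C)"
        using T C(1) disjoint_family_on_bisimulation[OF disj, of "\<lambda>i. T \<inter> ?B i"]
        by (intro emeasure_UN_countable) (auto simp: fmeasurableD)
      also have "\<dots> \<le> (\<integral>\<^sup>+i. ennreal q * emeasure lebesgue (?B i) \<partial>count_space C)"
      proof (intro nn_integral_mono)
        fix i assume "i \<in> space (count_space C)"
        then have "measure lebesgue (T \<inter> ?B i) \<le> q * measure lebesgue (?B i)"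
          using C(2) by (auto simp: K_def)
        moreover have "T \<inter> ?B i \<in> lmeasurable" "?B i \<in> lmeasurable"
          using T by (simp_all add: fmeasurable.Int)
        ultimately show "emeasure lebesgue (T \<inter> ?B i) \<le> ennreal q * emeasure lebesgue (?B i)"
          using q by (simp only: emeasure_eq_measure2 ennreal_mult'[symmetric] ennreal_leI)
      qed
      also have "\<dots> = ennreal q * (\<integral>\<^sup>+i. emeasure lebesgue (?B i) \<partial>count_space C)"
        by (intro nn_integral_cmult) auto
      also have "(\<integral>\<^sup>+i. emeasure lebesgue (?B i) \<partial>count_space C) = emeasure lebesgue (\<Union>i\<in>C. ?B i)"
        using C(1) disj by (intro emeasure_UN_countable[symmetric]) auto
      also have "ennreal q * \<dots> \<le> ennreal q * emeasure lebesgue U"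
        using C(2) Um by (intro mult_left_mono emeasure_mono UN_least) (fastforce simp: K_def fmeasurableD)+
      finally have "ennreal (measure lebesgue T) \<le> ennreal (q * measure lebesgue U)"
        using T Um q by (simp add: emeasure_eq_measure2 ennreal_mult')
      then have "measure lebesgue T \<le> q * measure lebesgue U"
        using q by (simp add: ennreal_le_iff)
      also have "\<dots> \<le> q * (measure lebesgue T + \<eta>)"
        using Ule q by (intro mult_left_mono)
      finally show ?thesis .
    qed
    have "measure lebesgue T \<le> 0"
    proof (rule ccontr)
      assume nonzero: "\<not> measure lebesgue T \<le> 0"
      define m where "m = measure lebesgue T"
      have "m > 0" using nonzero by (simp add: m_def)
      have "m * (1 - q) \<le> q * \<eta>" if "\<eta> > 0" for \<eta>
        using le[OF that] by (simp add: m_def algebra_simps)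
      \<comment> \<open>With this \<open>\<eta>\<close> the bound reads
        \<open>\<eta> \<le> q * \<eta>\<close>, impossible for \<open>\<eta> > 0\<close> and
        \<open>q < 1\<close>.\<close>
      from this[of "m * (1 - q)"] have "m * (1 - q) \<le> q * (m * (1 - q))"
        using \<open>m > 0\<close> q by simp
      moreover have "q * (m * (1 - q)) < 1 * (m * (1 - q))"
        using \<open>m > 0\<close> q by (intro mult_strict_right_mono) auto
      ultimately show False by simp
    qed
    then have "measure lebesgue T = 0"
      using measure_nonneg[of lebesgue T] by linarith
    then show ?thesis using T by (simp add: negligible_iff_measure)
  qed
  \<comment> \<open>\<open>bdd\<close> covers finite measure only, so \<open>S\<close> is exhausted
    by bounded pieces.\<close>
  have "negligible (\<Union>k::nat. S \<inter> cball 0 (real k))"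
    using S by (intro negligible_countable_Union bdd countableI_type)
      (auto intro!: fmeasurableI2[OF lmeasurable_cball[of 0]] intro: bdd)
  also have "(\<Union>k::nat. S \<inter> cball 0 (real k)) = S"
    using real_arch_simple by auto
  finally show False using pos by contradiction
qed

text \<open>At a density point all small radii are dense, so a single sparse radius below each
  \<open>e\<close> rules such points out.\<close>

lemma negligible_if_upper_density_lt_1:
  fixes S :: "'a::euclidean_space set"
  assumes S: "S \<in> sets lebesgue" and "\<delta> > 0"
    and sparse: "\<And>x e. x \<in> S \<Longrightarrow> e > 0 \<Longrightarrow>
      \<exists>r. 0 < r \<and> r < e \<and> measure lebesgue (S \<inter> cball x r) \<le> (1 - \<delta>) * measure lebesgue (cball x r)"
  shows "negligible S"
proof (rule ccontr)
  assume "\<not> negligible S"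
  then obtain x e where x: "x \<in> S" "e > 0" and dens:
    "\<And>r. 0 < r \<Longrightarrow> r < e \<Longrightarrow> (1 - \<delta>) * measure lebesgue (cball x r) < measure lebesgue (S \<inter> cball x r)"
    by (rule exists_density_point[OF S _ \<open>\<delta> > 0\<close>]) (rule that)
  from sparse[OF x] obtain r where r: "0 < r" "r < e"
    "measure lebesgue (S \<inter> cball x r) \<le> (1 - \<delta>) * measure lebesgue (cball x r)"
    by blast
  with dens[OF r(1,2)] show False by linarith
qed

text \<open>Each index carries a whole set of centres with a common radius. An index without centres
  contributes nothing, so indices can be switched off without changing the radii.\<close>

definition limsup_balls :: "(nat \<Rightarrow> real set) \<Rightarrow> (nat \<Rightarrow> real) \<Rightarrow> real set" where
  "limsup_balls A r = {x. \<exists>\<^sub>F n in sequentially. \<exists>a\<in>A n. dist a x < r n}"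

lemma limsup_balls_eq: "limsup_balls A r = (\<Inter>N. \<Union>n\<in>{N..}. \<Union>a\<in>A n. ball a (r n))"
  by (auto simp: limsup_balls_def frequently_sequentially Bex_def)

lemma borel_limsup_balls [measurable]: "limsup_balls A r \<in> sets borel"
  unfolding limsup_balls_eq by (intro sets.countable_INT'') (auto intro!: borel_open open_UN)

lemma lebesgue_limsup_balls [simp]: "limsup_balls A r \<in> sets lebesgue"
  using borel_limsup_balls[of A r] by (simp add: sets_completionI_sets)

text \<open>
  A point covered by infinitely many dilated balls, but by only finitely many of the original ones,
  sees balls of a fixed proportion missing at arbitrarily small scales.
\<close>

lemma negligible_limsup_balls_dilate:
  assumes r: "r \<longlonglongrightarrow> 0" and c: "c \<ge> (1::real)"
  shows "negligible (limsup_balls A (\<lambda>n. c * r n) - limsup_balls A r)"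
proof -
  let ?D = "limsup_balls A (\<lambda>n. c * r n)"
  \<comment> \<open>On each of these countably many pieces the original balls are avoided from a
    fixed index on.\<close>
  define S where "S N = ?D - (\<Union>n\<in>{N..}. \<Union>a\<in>A n. ball a (r n))" for N
  have "negligible (S N)" for N
  proof (rule negligible_if_upper_density_lt_1)
    show S: "S N \<in> sets lebesgue"
      unfolding S_def
      by (intro sets.Diff lebesgue_limsup_balls sets_completionI_sets) (simp add: borel_open open_UN)
    show "1 / (1 + c) > 0" using c by simp
    fix x e :: real assume x: "x \<in> S N" "e > 0"
    have "eventually (\<lambda>n. r n < e / (1 + c)) sequentially"
      using order_tendstoD(2)[OF r, of "e / (1 + c)"] x c by simp
    moreover have "\<exists>\<^sub>F n in sequentially. \<exists>a\<in>A n. dist a x < c * r n"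
      using x by (simp add: S_def limsup_balls_def)
    moreover have "eventually (\<lambda>n. n \<ge> N) sequentially" by (rule eventually_ge_at_top)
    ultimately have "\<exists>\<^sub>F n in sequentially. (\<exists>a\<in>A n. dist a x < c * r n) \<and> r n < e / (1 + c) \<and> n \<ge> N"
      by (simp add: frequently_eventually_frequently eventually_conj)
    then obtain n a where n: "n \<ge> N" "r n < e / (1 + c)" "a \<in> A n" "dist a x < c * r n"
      by (auto dest!: frequently_ex)
    have "0 < c * r n" using n(4) zero_le_dist by (rule le_less_trans[rotated])
    then have rn: "r n > 0" using c by (simp add: zero_less_mult_iff)
    \<comment> \<open>As \<open>dist a x < c * r n\<close>, this radius around \<open>x\<close>
      takes in the whole avoided ball, whose share \<open>1 / (1 + c)\<close> does not depend on
      \<open>n\<close>.\<close>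
    define R where "R = (1 + c) * r n"
    have R: "R > 0" "R < e" using rn n c by (simp_all add: R_def field_simps add_pos_pos)
    have sub: "ball a (r n) \<subseteq> cball x R"
    proof
      fix w assume "w \<in> ball a (r n)"
      then show "w \<in> cball x R"
        using n(4) dist_triangle[of x w a] by (simp add: R_def algebra_simps dist_commute)
    qed
    have "measure lebesgue (S N \<inter> cball x R) \<le> measure lebesgue (cball x R - ball a (r n))"
      using n S by (intro measure_mono_fmeasurable fmeasurable.Diff) (auto simp: S_def)
    also have "\<dots> = measure lebesgue (cball x R) - measure lebesgue (ball a (r n))"
      using sub by (intro measurable_measure_Diff) auto
    also have "\<dots> = (1 - 1 / (1 + c)) * measure lebesgue (cball x R)"
      using R rn c by (simp add: R_def cball_eq_atLeastAtMost ball_eq_greaterThanLessThan field_simps)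
    finally show "\<exists>R>0. R < e \<and> measure lebesgue (S N \<inter> cball x R)
        \<le> (1 - 1 / (1 + c)) * measure lebesgue (cball x R)"
      using R by blast
  qed
  then have "negligible (\<Union>N. S N)" by (intro negligible_countable_Union) auto
  also have "(\<Union>N. S N) = ?D - limsup_balls A r"
    by (auto simp: S_def limsup_balls_eq[of A r])
  finally show ?thesis .
qed


section \<open>Measure of periodic sets\<close>

lemma measure_affine_image_real:
  fixes S :: "real set"
  shows "measure lebesgue ((\<lambda>x. c * x + t) ` S) = \<bar>c\<bar> * measure lebesgue S"
  using measure_lebesgue_affine[of c t S] by simp

text \<open>For a Borel set the image is a preimage under the continuous inverse map, hence Borel
  again.\<close>

lemma lebesgue_affine_image_real:
  fixes S :: "real set"
  assumes S: "S \<in> sets borel" and "c \<noteq> 0"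
  shows "(\<lambda>x. c * x + t) ` S \<in> sets lebesgue"
proof -
  have "(\<lambda>x. c * x + t) ` S = (\<lambda>y. (y - t) / c) -` S \<inter> space borel"
    using \<open>c \<noteq> 0\<close> by (force simp: image_iff)
  also have "\<dots> \<in> sets borel"
    using S by (intro measurable_sets[of _ borel borel]) auto
  finally show ?thesis by (simp add: sets_completionI_sets)
qed

lemma lmeasurable_Int_Ico: "S \<in> sets lebesgue \<Longrightarrow> S \<inter> {a..<b::real} \<in> lmeasurable"
  by (rule fmeasurableI2[OF lmeasurable_interval(1)[of a b]]) auto

lemma measure_periodic_shift:
  fixes S :: "real set" and t :: real
  assumes per: "\<And>x. x + t \<in> S \<longleftrightarrow> x \<in> S"
  shows "measure lebesgue (S \<inter> {a + t..<b + t}) = measure lebesgue (S \<inter> {a..<b})"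
proof -
  have "(\<lambda>x. 1 * x + t) ` (S \<inter> {a..<b}) = S \<inter> {a + t..<b + t}"
  proof (intro equalityI subsetI)
    fix x assume "x \<in> S \<inter> {a + t..<b + t}"
    then show "x \<in> (\<lambda>x. 1 * x + t) ` (S \<inter> {a..<b})"
      using per[of "x - t"] by (intro image_eqI[of _ _ "x - t"]) auto
  qed (use per in auto)
  then show ?thesis
    using measure_affine_image_real[of 1 t "S \<inter> {a..<b}"] by simp
qed

lemma measure_Ico_split:
  fixes S :: "real set"
  assumes "S \<in> sets lebesgue" "a \<le> b" "b \<le> c"
  shows "measure lebesgue (S \<inter> {a..<c}) = measure lebesgue (S \<inter> {a..<b}) + measure lebesgue (S \<inter> {b..<c})"
proof -
  have "S \<inter> {a..<c} = S \<inter> {a..<b} \<union> S \<inter> {b..<c}" using assms by auto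
  then show ?thesis
    using assms measure_Un3[OF lmeasurable_Int_Ico[of S a b] lmeasurable_Int_Ico[of S b c]]
    by (auto simp: Int_ac)
qed

lemma periodic_shift_of_int:
  fixes S :: "real set" and t :: real
  assumes per: "\<And>x. x + t \<in> S \<longleftrightarrow> x \<in> S"
  shows "x + of_int k * t \<in> S \<longleftrightarrow> x \<in> S"
proof (induction k rule: int_induct[of _ 0])
  case (step1 i)
  then show ?case using per[of "x + of_int i * t"] by (simp add: algebra_simps)
next
  case (step2 i)
  then show ?case using per[of "x + of_int (i - 1) * t"] by (simp add: algebra_simps)
qed simp

text \<open>Modulo \<open>t\<close> the window starts at some \<open>v\<close> in
  \<open>[0, t)\<close>; its part beyond \<open>t\<close> is moved back to
  \<open>[0, v)\<close>.\<close>

lemma measure_periodic_window: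
  fixes S :: "real set" and t :: real
  assumes S: "S \<in> sets lebesgue" and t: "t > 0" and per: "\<And>x. x + t \<in> S \<longleftrightarrow> x \<in> S"
  shows "measure lebesgue (S \<inter> {u..<u + t}) = measure lebesgue (S \<inter> {0..<t})"
proof -
  define k where "k = \<lfloor>u / t\<rfloor>"
  define v where "v = u - of_int k * t"
  have "of_int k \<le> u / t" "u / t < of_int k + 1" unfolding k_def by linarith+
  then have v: "0 \<le> v" "v < t" using t by (simp_all add: v_def field_simps)
  have "measure lebesgue (S \<inter> {u..<u + t}) = measure lebesgue (S \<inter> {v..<v + t})"
    using measure_periodic_shift[where t = "of_int k * t" and S = S and a = v and b = "v + t"]
      periodic_shift_of_int[of t S, OF per] by (simp add: v_def algebra_simps)
  also have "\<dots> = measure lebesgue (S \<inter> {v..<t}) + measure lebesgue (S \<inter> {t..<v + t})"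
    using v S by (intro measure_Ico_split) auto
  also have "measure lebesgue (S \<inter> {t..<v + t}) = measure lebesgue (S \<inter> {0..<v})"
    using measure_periodic_shift[OF per, of 0 v] by simp
  also have "measure lebesgue (S \<inter> {v..<t}) + \<dots> = measure lebesgue (S \<inter> {0..<t})"
    using measure_Ico_split[OF S, of 0 v t] v by simp
  finally show ?thesis .
qed

lemma measure_periodic_multiple:
  fixes S :: "real set" and t :: real
  assumes S: "S \<in> sets lebesgue" and t: "t > 0" and per: "\<And>x. x + t \<in> S \<longleftrightarrow> x \<in> S"
  shows "measure lebesgue (S \<inter> {0..<real n * t}) = real n * measure lebesgue (S \<inter> {0..<t})"
proof (induction n)
  case (Suc n)
  have "measure lebesgue (S \<inter> {0..<real (Suc n) * t}) =
      measure lebesgue (S \<inter> {0..<real n * t}) + measure lebesgue (S \<inter> {real n * t..<real n * t + t})"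
    using measure_Ico_split[OF S, of 0 "real n * t" "real n * t + t"] t by (simp add: algebra_simps)
  then show ?case
    using Suc measure_periodic_window[OF S t per, of "real n * t"] by (simp add: algebra_simps)
qed simp

lemma measure_cball_le_Ico:
  fixes S :: "real set"
  assumes S: "S \<in> sets lebesgue"
  shows "measure lebesgue (S \<inter> cball x r) \<le> measure lebesgue (S \<inter> {x - r..<x + r})"
proof -
  have "measure lebesgue (S \<inter> cball x r) \<le> measure lebesgue (S \<inter> {x - r..<x + r} \<union> {x + r})"
    using S by (intro measure_mono_fmeasurable fmeasurable.Un lmeasurable_Int_Ico sets.Int)
      (auto simp: cball_eq_atLeastAtMost negligible_imp_measurable)
  also have "\<dots> \<le> measure lebesgue (S \<inter> {x - r..<x + r}) + measure lebesgue {x + r}"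
    using S by (intro measure_Un_le) auto
  finally show ?thesis by simp
qed

text \<open>Turns local density into a global bound: the ball is one period up to an endpoint, and
  \<open>n\<close> periods fill \<open>[0, 1)\<close>.\<close>

lemma unit_measure_ge_cball:
  fixes S :: "real set"
  assumes S: "S \<in> sets lebesgue" and "n > 0" and per: "\<And>x. x + 1 / real n \<in> S \<longleftrightarrow> x \<in> S"
  shows "real n * measure lebesgue (S \<inter> cball x (1 / (2 * real n))) \<le> unit_measure S"
proof -
  have "measure lebesgue (S \<inter> cball x (1 / (2 * real n))) \<le>
      measure lebesgue (S \<inter> {x - 1 / (2 * real n)..<x + 1 / (2 * real n)})"
    by (rule measure_cball_le_Ico[OF S])
  also have "\<dots> = measure lebesgue (S \<inter> {0..<1 / real n})"
    using measure_periodic_window[OF S _ per, of "x - 1 / (2 * real n)"] \<open>n > 0\<close>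
    by (simp add: field_simps)
  finally have "real n * measure lebesgue (S \<inter> cball x (1 / (2 * real n))) \<le>
      real n * measure lebesgue (S \<inter> {0..<1 / real n})"
    by (rule mult_left_mono) simp
  also have "\<dots> = unit_measure S"
    using measure_periodic_multiple[OF S _ per, of n] \<open>n > 0\<close> by (simp add: unit_measure_def)
  finally show ?thesis .
qed

lemma unit_measure_mono:
  assumes "S \<in> sets lebesgue" "T \<in> sets lebesgue" "negligible (S - T)"
  shows "unit_measure S \<le> unit_measure T"
proof -
  have "measure lebesgue (S \<inter> {0..<1}) \<le> measure lebesgue (T \<inter> {0..<1} \<union> (S - T))"
    using assms by (intro measure_mono_fmeasurable fmeasurable.Un lmeasurable_Int_Ico)
      (auto simp: negligible_imp_measurable)
  also have "\<dots> \<le> measure lebesgue (T \<inter> {0..<1}) + measure lebesgue (S - T)"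
    using assms by (intro measure_Un_le) auto
  also have "measure lebesgue (S - T) = 0"
    using assms by (simp add: negligible_imp_measure0)
  finally show ?thesis by (simp add: unit_measure_def)
qed

lemma AE_if_unit_measure_eq_1:
  assumes S: "S \<in> sets lebesgue" and per: "\<And>x. x + 1 \<in> S \<longleftrightarrow> x \<in> S" and one: "unit_measure S = 1"
  shows "AE x in lebesgue. x \<in> S"
proof -
  have null: "negligible ({of_int k..<of_int k + 1} - S)" for k :: int
  proof -
    have "measure lebesgue (S \<inter> {of_int k..<of_int k + 1}) = 1"
      using measure_periodic_window[OF S _ per, of "of_int k"] one by (simp add: unit_measure_def)
    moreover have "measure lebesgue ({of_int k..<of_int k + 1} - S \<inter> {of_int k..<of_int k + 1}) =
        measure lebesgue {of_int k..<of_int k + 1::real} - measure lebesgue (S \<inter> {of_int k..<of_int k + 1})"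
      using S lmeasurable_Int_Ico[of UNIV] by (intro measurable_measure_Diff) auto
    ultimately have "measure lebesgue ({of_int k..<of_int k + 1} - S) = 0"
      by (simp add: Diff_Int)
    moreover have "{of_int k..<of_int k + 1} - S \<in> lmeasurable"
      using lmeasurable_Int_Ico[of "- S"] sets.compl_sets[OF S] by (simp add: Diff_eq Int_commute)
    ultimately show ?thesis by (simp add: negligible_iff_measure)
  qed
  have "negligible (\<Union>k::int. {of_int k..<of_int k + 1} - S)"
    using null by (intro negligible_countable_Union) auto
  moreover have "- S \<subseteq> (\<Union>k::int. {of_int k..<of_int k + 1} - S)"
  proof
    fix x assume "x \<in> - S"
    moreover have "of_int \<lfloor>x\<rfloor> \<le> x" "x < of_int \<lfloor>x\<rfloor> + 1" by linarith+
    ultimately show "x \<in> (\<Union>k::int. {of_int k..<of_int k + 1} - S)"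
      by (intro UN_I[of "\<lfloor>x\<rfloor>"]) auto
  qed
  ultimately have "negligible (- S)" by (rule negligible_subset)
  then show ?thesis
    by (simp add: negligible_iff_null_sets AE_iff_null_sets Compl_eq eventually_ae_filter) blast
qed


section \<open>Gaps between integers coprime to \<open>n\<close>\<close>

lemma exists_cong_1_near:
  fixes t :: real and d :: nat
  assumes "d > 0"
  obtains u :: int where "int d dvd u - 1" "t \<le> of_int u" "of_int u < t + real d"
proof
  define k where "k = \<lceil>(t - 1) / real d\<rceil>"
  have "(t - 1) / real d \<le> of_int k" "of_int k < (t - 1) / real d + 1"
    unfolding k_def by linarith+
  then show "t \<le> of_int (1 + int d * k)" "of_int (1 + int d * k) < t + real d"
    using assms by (simp_all add: field_simps)
qed simp

lemma coprime_if_cong_1: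
  fixes u d :: int
  assumes "d dvd u - 1"
  shows "coprime u d"
proof (rule coprimeI)
  fix c assume "c dvd u" "c dvd d"
  then have "c dvd u - (u - 1)" using assms by (meson dvd_diff dvd_trans)
  then show "is_unit c" by simp
qed

text \<open>
  If all prime factors of \<open>n\<close> are at most \<open>K\<close>, integers congruent to 1 modulo \<open>K!\<close> are coprime to
  \<open>n\<close>. Otherwise \<open>n = p^j m\<close> with \<open>p > K\<close> prime not dividing \<open>m\<close>, and of two consecutive integers
  congruent to 1 modulo \<open>m\<close> at least one is not divisible by \<open>p\<close>.
\<close>

lemma exists_coprime_near:
  fixes c :: real
  assumes "c > 0"
  obtains N where "\<And>(n::nat) (t::real). n \<ge> N \<Longrightarrow> \<exists>a::int. coprime a (int n) \<and> \<bar>t - of_int a\<bar> < c * real n"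
proof -
  \<comment> \<open>\<open>c * K > 2\<close> serves both cases: it gives
    \<open>fact K \<le> c * n\<close> once \<open>n \<ge> K * fact K\<close>, and it absorbs the
    factor 2 from using two consecutive candidates when a prime above \<open>K\<close> divides
    \<open>n\<close>.\<close>
  obtain K :: nat where K: "2 / c < real K" using reals_Archimedean2 by blast
  have "K > 0" using K assms by (cases K) (auto simp: field_simps)
  have "\<exists>a::int. coprime a (int n) \<and> \<bar>t - of_int a\<bar> < c * real n" if n: "n \<ge> K * fact K" for n :: nat and t :: real
  proof (cases "\<forall>p. prime p \<and> p dvd n \<longrightarrow> p \<le> K")
    case True
    obtain u where u: "int (fact K) dvd u - 1" "t \<le> of_int u" "of_int u < t + real (fact K)"
      using exists_cong_1_near[of "fact K" t] by auto
    have "n > 0" using n \<open>K > 0\<close> by (cases n) auto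
    have "coprime u (int n)"
    proof (rule ccontr)
      assume "\<not> coprime u (int n)"
      then have "nat (gcd u (int n)) \<noteq> 1" by (auto simp: coprime_iff_gcd_eq_1)
      then obtain q where q: "prime q" "q dvd nat (gcd u (int n))"
        using prime_factor_nat by blast
      then have "int q dvd gcd u (int n)" by (metis gcd_ge_0_int int_dvd_int_iff int_nat_eq)
      then have qd: "int q dvd u" "q dvd n" by auto
      have "q dvd fact K" using True q qd prime_dvd_fact_iff by blast
      then have "int q dvd u - 1" using u(1) by (metis dvd_trans int_dvd_int_iff)
      then have "int q dvd u - (u - 1)" using qd(1) by (rule dvd_diff[rotated])
      then show False using q(1) by simp
    qed
    moreover have "real (fact K) \<le> c * real n"
    proof -
      have "1 \<le> c * real K" using K assms by (simp add: field_simps)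
      then have "1 * real (fact K) \<le> c * real K * real (fact K)"
        by (intro mult_right_mono) auto
      also have "\<dots> = c * real (K * fact K)" by simp
      also have "\<dots> \<le> c * real n" using n assms by (intro mult_left_mono) (auto simp only: of_nat_le_iff)
      finally show ?thesis by simp
    qed
    ultimately show ?thesis using u by (intro exI[of _ u]) auto
  next
    case False
    then obtain p where p: "prime p" "p dvd n" "p > K" by auto
    have "n > 0" using n \<open>K > 0\<close> by (cases n) auto
    obtain m where m: "n = p ^ multiplicity p n * m" "\<not> p dvd m"
      using multiplicity_decompose'[of n p] p \<open>n > 0\<close> by (metis not_prime_unit less_not_refl)
    have "m > 0" using m \<open>n > 0\<close> by (cases m) auto
    have "multiplicity p n \<noteq> 0" using p m by (metis mult_1 power_0)
    then have "p \<le> p ^ multiplicity p n"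
      using p(1) by (metis dvd_imp_le dvd_power not_gr_zero prime_gt_0_nat zero_less_power)
    then have pm: "p * m \<le> n" using m(1) by (metis mult_le_mono1)
    obtain u where u: "int m dvd u - 1" "t \<le> of_int u" "of_int u < t + real m"
      using exists_cong_1_near[of m t] \<open>m > 0\<close> by auto
    have "\<not> (int p dvd u \<and> int p dvd u + int m)"
      using m(2) by (metis dvd_add_right_iff int_dvd_int_iff)
    then obtain v where v: "v = u \<or> v = u + int m" "\<not> int p dvd v" by blast
    have "u + int m - 1 = (u - 1) + int m" by simp
    then have "int m dvd v - 1" using u(1) v(1) by (metis dvd_add dvd_refl)
    then have "coprime v (int m)" by (rule coprime_if_cong_1)
    moreover have "coprime v (int p ^ multiplicity p n)"
      using v(2) p(1) by (metis coprime_commute coprime_power_right_iff prime_imp_coprime prime_nat_int_transfer)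
    ultimately have "coprime v (int n)" by (subst m(1)) simp
    moreover have "\<bar>t - of_int v\<bar> < c * real n"
    proof -
      have "\<bar>t - of_int v\<bar> < 2 * real m" using v(1) u by auto
      also have "2 * real m < c * (real p * real m)"
      proof -
        have "2 < c * real K" using K assms by (simp add: field_simps)
        also have "\<dots> \<le> c * real p" using p assms by simp
        finally show ?thesis using \<open>m > 0\<close> by (simp add: mult.assoc[symmetric])
      qed
      also have "\<dots> \<le> c * real n" using pm assms by (intro mult_left_mono) (auto simp flip: of_nat_mult)
      finally show ?thesis by simp
    qed
    ultimately show ?thesis by blast
  qed
  then show thesis by (rule that)
qed

section \<open>The approximation sets\<close>

text \<open>For \<open>n \<ge> 1\<close>, the balls of radius \<open>\<psi> n / n\<close> about
  these points are the solution sets of \<open>\<bar>n * x - a + z\<bar> < \<psi> n\<close>.\<close>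

definition coprime_centres :: "real \<Rightarrow> nat \<Rightarrow> real set" where
  "coprime_centres z n = {(of_int a - z) / real n |a. coprime a (int n)}"

text \<open>Denominators outside \<open>Q\<close> get no centres while the radii stay the same, so
  the dilation lemma applies to every part.\<close>

definition restricted_approx_set :: "(nat \<Rightarrow> bool) \<Rightarrow> (nat \<Rightarrow> real) \<Rightarrow> real \<Rightarrow> real set" where
  "restricted_approx_set Q \<psi> z =
     limsup_balls (\<lambda>n. if Q n then coprime_centres z n else {}) (\<lambda>n. \<psi> n / real n)"

lemma lebesgue_restricted_approx_set [simp]: "restricted_approx_set Q \<psi> z \<in> sets lebesgue"
  by (simp add: restricted_approx_set_def)

lemma mem_restricted_approx_set:
  "x \<in> restricted_approx_set Q \<psi> z \<longleftrightarrow>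
    (\<exists>\<^sub>F n in sequentially. n \<ge> 1 \<and> Q n \<and> (\<exists>a::int. coprime a (int n) \<and> \<bar>real n * x - of_int a + z\<bar> < \<psi> n))"
proof -
  have "(\<exists>a\<in>(if Q n then coprime_centres z n else {}). dist a x < \<psi> n / real n) \<longleftrightarrow>
      n \<ge> 1 \<and> Q n \<and> (\<exists>a::int. coprime a (int n) \<and> \<bar>real n * x - of_int a + z\<bar> < \<psi> n)" if "n \<ge> 1" for n
  proof -
    have "dist ((of_int a - z) / real n) x < \<psi> n / real n \<longleftrightarrow> \<bar>real n * x - of_int a + z\<bar> < \<psi> n" for a :: int
    proof -
      have "dist ((of_int a - z) / real n) x = \<bar>(real n * x - of_int a + z) / real n\<bar>"
        using that by (subst abs_minus_commute[symmetric] | simp add: dist_real_def field_simps)+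
      also have "\<dots> = \<bar>real n * x - of_int a + z\<bar> / real n" by (simp add: abs_divide)
      finally show ?thesis using that by (simp add: divide_less_cancel)
    qed
    then show ?thesis using that by (auto simp: coprime_centres_def)
  qed
  then show ?thesis
    unfolding restricted_approx_set_def limsup_balls_def mem_Collect_eq
    \<comment> \<open>Index 0, where the division takes its default value 0, does not affect a
      limsup set.\<close>
    by (intro frequently_cong[OF eventually_ge_at_top[of 1]])
qed

text \<open>For fixed \<open>n\<close> only finitely many \<open>a\<close> satisfy the inequality,
  so infinitely many pairs means infinitely many \<open>n\<close>.\<close>

lemma inhom_approx_set_eq: "inhom_approx_set \<psi> z = restricted_approx_set (\<lambda>_. True) \<psi> z"
proof (intro set_eqI)
  fix x
  define P where "P = {(a :: int, n :: nat).
    n \<ge> 1 \<and> coprime a (int n) \<and> \<bar>real n * x - real_of_int a + z\<bar> < \<psi> n}"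
  have fib: "finite {a :: int. \<bar>real n * x - real_of_int a + z\<bar> < \<psi> n}" for n
  proof (rule finite_subset)
    show "{a :: int. \<bar>real n * x - real_of_int a + z\<bar> < \<psi> n} \<subseteq>
        {\<lfloor>real n * x + z - \<psi> n\<rfloor>..\<lceil>real n * x + z + \<psi> n\<rceil>}"
      by (auto simp: abs_less_iff) linarith+
  qed simp
  have "P \<subseteq> (\<Union>n\<in>snd ` P. (\<lambda>a. (a, n)) ` {a :: int. \<bar>real n * x - real_of_int a + z\<bar> < \<psi> n})"
    by (force simp: P_def)
  then have "finite P \<longleftrightarrow> finite (snd ` P)"
    using fib by (metis (no_types, lifting) finite_UN_I finite_imageI finite_subset)
  moreover have "snd ` P = {n. n \<ge> 1 \<and> True \<and> (\<exists>a::int. coprime a (int n) \<and> \<bar>real n * x - of_int a + z\<bar> < \<psi> n)}"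
    by (force simp: P_def)
  ultimately show "x \<in> inhom_approx_set \<psi> z \<longleftrightarrow> x \<in> restricted_approx_set (\<lambda>_. True) \<psi> z"
    unfolding mem_restricted_approx_set
    unfolding inhom_approx_set_def mem_Collect_eq P_def[symmetric] cofinite_eq_sequentially[symmetric]
      frequently_cofinite by simp
qed


text \<open>For large \<open>n\<close> some integer coprime to \<open>n\<close> lies within
  \<open>c * n\<close> of \<open>n * x + z\<close>, whatever \<open>x\<close> is.\<close>

lemma inhom_approx_set_eq_UNIV:
  assumes "c > 0" and freq: "\<exists>\<^sub>F n in sequentially. \<psi> n / real n \<ge> c"
  shows "inhom_approx_set \<psi> z = UNIV"
proof -
  obtain N where N: "\<And>(n::nat) (t::real). n \<ge> N \<Longrightarrow> \<exists>a::int. coprime a (int n) \<and> \<bar>t - of_int a\<bar> < c * real n"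
    by (rule exists_coprime_near[OF \<open>c > 0\<close>]) (rule that)
  have "x \<in> restricted_approx_set (\<lambda>_. True) \<psi> z" for x
    unfolding mem_restricted_approx_set
  proof (rule frequently_elim1[OF frequently_eventually_frequently[OF freq
        eventually_conj[OF eventually_ge_at_top[of N] eventually_ge_at_top[of 1]]]])
    fix n assume n: "c \<le> \<psi> n / real n \<and> N \<le> n \<and> 1 \<le> n"
    then obtain a where "coprime a (int n)" "\<bar>(real n * x + z) - real_of_int a\<bar> < c * real n"
      using N by blast
    moreover have "c * real n \<le> \<psi> n" using n pos_le_divide_eq[of "real n" c "\<psi> n"] by simp
    ultimately show "n \<ge> 1 \<and> True \<and> (\<exists>a. coprime a (int n) \<and> \<bar>real n * x - real_of_int a + z\<bar> < \<psi> n)"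
      using n by (auto simp: algebra_simps intro!: exI[of _ a])
  qed
  then show ?thesis by (auto simp: inhom_approx_set_eq)
qed

section \<open>Affine maps between approximation sets, periodicity and splitting\<close>

text \<open>With \<open>b = M * a + n * s\<close> one has
  \<open>n * (M * x + s) - b + M * z = M * (n * x - a + z)\<close>; \<open>step\<close> keeps the
  new numerator an integer coprime to \<open>n\<close>.\<close>

lemma restricted_approx_set_affine:
  assumes "M > 0"
    and step: "\<And>n a. Q n \<Longrightarrow> n \<ge> 1 \<Longrightarrow> coprime a (int n) \<Longrightarrow>
      \<exists>b. coprime b (int n) \<and> of_int b = real M * of_int a + real n * s"
    and x: "x \<in> restricted_approx_set Q \<psi> z"
  shows "real M * x + s \<in> restricted_approx_set Q (\<lambda>n. real M * \<psi> n) (real M * z)"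
  using x unfolding mem_restricted_approx_set
proof (rule frequently_elim1)
  fix n assume n: "n \<ge> 1 \<and> Q n \<and> (\<exists>a. coprime a (int n) \<and> \<bar>real n * x - real_of_int a + z\<bar> < \<psi> n)"
  then obtain a where a: "coprime a (int n)" "\<bar>real n * x - real_of_int a + z\<bar> < \<psi> n" by blast
  obtain b where b: "coprime b (int n)" "of_int b = real M * of_int a + real n * s"
    using step[of n a] n a by blast
  have "real n * (real M * x + s) - of_int b + real M * z = real M * (real n * x - of_int a + z)"
    unfolding b(2) by (simp add: algebra_simps)
  then have "\<bar>real n * (real M * x + s) - of_int b + real M * z\<bar> = real M * \<bar>real n * x - of_int a + z\<bar>"
    by (simp add: abs_mult)
  also have "\<dots> < real M * \<psi> n" using a(2) assms(1) by simp
  finally show "n \<ge> 1 \<and> Q n \<and>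
      (\<exists>a. coprime a (int n) \<and> \<bar>real n * (real M * x + s) - real_of_int a + real M * z\<bar> < real M * \<psi> n)"
    using n b(1) by blast
qed

text \<open>The case \<open>M = 1\<close>, used for both \<open>s\<close> and \<open>- s\<close>;
  hence both signs of \<open>d\<close> in the hypothesis.\<close>

lemma restricted_approx_set_shift:
  assumes "\<And>n a. Q n \<Longrightarrow> n \<ge> 1 \<Longrightarrow> coprime a (int n) \<Longrightarrow>
      \<exists>d. of_int d = real n * s \<and> coprime (a + d) (int n) \<and> coprime (a - d) (int n)"
  shows "x + s \<in> restricted_approx_set Q \<psi> z \<longleftrightarrow> x \<in> restricted_approx_set Q \<psi> z"
proof
  assume "x \<in> restricted_approx_set Q \<psi> z"
  then show "x + s \<in> restricted_approx_set Q \<psi> z"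
    using restricted_approx_set_affine[of 1 Q s x \<psi> z] assms by fastforce
next
  have "\<exists>b. coprime b (int n) \<and> of_int b = real 1 * of_int a + real n * (- s)"
    if an: "Q n" "n \<ge> 1" "coprime a (int n)" for n a
  proof -
    obtain d where "of_int d = real n * s" "coprime (a - d) (int n)" using assms[OF an] by blast
    then show ?thesis by (intro exI[of _ "a - d"]) simp
  qed
  moreover assume "x + s \<in> restricted_approx_set Q \<psi> z"
  ultimately show "x \<in> restricted_approx_set Q \<psi> z"
    using restricted_approx_set_affine[of 1 Q "- s" "x + s" \<psi> z] by simp
qed

lemma restricted_approx_set_periodic:
  "x + 1 \<in> restricted_approx_set Q \<psi> z \<longleftrightarrow> x \<in> restricted_approx_set Q \<psi> z"
proof (rule restricted_approx_set_shift)
  fix n a assume "coprime a (int n)"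
  then show "\<exists>d. of_int d = real n * 1 \<and> coprime (a + d) (int n) \<and> coprime (a - d) (int n)"
    by (intro exI[of _ "int n"]) (simp add: coprime_iff_gcd_eq_1 gcd_diff1)
qed

lemma restricted_approx_set_mono:
  assumes "\<And>n. Q n \<Longrightarrow> Q' n"
  shows "restricted_approx_set Q \<psi> z \<subseteq> restricted_approx_set Q' \<psi> z"
  using assms unfolding mem_restricted_approx_set subset_iff by (auto elim: frequently_elim1)

lemma restricted_approx_set_disj:
  "restricted_approx_set (\<lambda>n. Q n \<or> Q' n) \<psi> z = restricted_approx_set Q \<psi> z \<union> restricted_approx_set Q' \<psi> z"
  unfolding set_eq_iff Un_iff mem_restricted_approx_set frequently_disj_iff[symmetric]
  by (simp add: conj_disj_distribL conj_disj_distribR)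

text \<open>The factor \<open>M\<close> that an expansion puts on \<open>\<psi>\<close> costs
  nothing in measure, by \<open>negligible_limsup_balls_dilate\<close>.\<close>

lemma unit_measure_dilated_le:
  assumes "M > 0" and lim: "(\<lambda>n. \<psi> n / real n) \<longlonglongrightarrow> 0"
  shows "unit_measure (restricted_approx_set Q (\<lambda>n. real M * \<psi> n) z) \<le> unit_measure (inhom_approx_set \<psi> z)"
proof -
  have "unit_measure (restricted_approx_set Q (\<lambda>n. real M * \<psi> n) z) \<le> unit_measure (restricted_approx_set Q \<psi> z)"
  proof (rule unit_measure_mono)
    show "negligible (restricted_approx_set Q (\<lambda>n. real M * \<psi> n) z - restricted_approx_set Q \<psi> z)"
      using negligible_limsup_balls_dilate[OF lim, of "real M"] \<open>M > 0\<close>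
      by (simp add: restricted_approx_set_def)
  qed auto
  also have "\<dots> \<le> unit_measure (inhom_approx_set \<psi> z)"
  proof -
    have "restricted_approx_set Q \<psi> z - restricted_approx_set (\<lambda>_. True) \<psi> z = {}"
      using restricted_approx_set_mono[of Q "\<lambda>_. True"] by blast
    then show ?thesis by (simp add: inhom_approx_set_eq unit_measure_mono)
  qed
  finally show ?thesis .
qed

section \<open>Numerators coprime to \<open>n\<close> under expansion by \<open>p ^ k\<close> and
  shift by \<open>n / p\<close>\<close>

lemma expand_coprime_not_dvd:
  assumes "prime p" "\<not> p dvd n" "coprime a (int n)"
  shows "\<exists>b. coprime b (int n) \<and> of_int b = real (p ^ k) * of_int a + real n * 0"
proof (intro exI conjI)
  have "coprime (int p) (int n)" using assms by (simp add: prime_imp_coprime)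
  then show "coprime (int p ^ k * a) (int n)" using assms by simp
qed simp

text \<open>Expansion alone would make the numerator divisible by \<open>p\<close>. Adding
  \<open>m = n / p\<close>, which is prime to \<open>p\<close>, repairs this and changes nothing
  modulo \<open>m\<close>.\<close>

lemma expand_coprime_exactly_dvd:
  assumes "prime p" "p dvd n" "\<not> p\<^sup>2 dvd n" "coprime a (int n)" "k \<ge> 1"
  shows "\<exists>b. coprime b (int n) \<and> of_int b = real (p ^ k) * of_int a + real n * (1 / real p)"
proof -
  obtain m where m: "n = p * m" using assms by blast
  have p: "p > 0" using assms by (simp add: prime_gt_0_nat)
  have "\<not> p dvd m" using assms m p by (auto simp: power2_eq_square)
  then have pm: "coprime (int p) (int m)" using assms by (simp add: prime_imp_coprime)
  obtain j where j: "k = Suc j" using assms by (cases k) auto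
  have "coprime (int p ^ k * a + int m) (int m)"
    using pm assms m by (simp add: coprime_iff_gcd_eq_1[of "_ + _"])
  moreover have "coprime (int p ^ k * a + int m) (int p)"
    using pm gcd_add_mult[of "int p" "int p ^ j * a" "int m"]
    by (simp add: j coprime_iff_gcd_eq_1 gcd.commute mult_ac)
  ultimately show ?thesis
    using p m by (intro exI[of _ "int p ^ k * a + int m"]) auto
qed

text \<open>Here \<open>n / p\<close> has the same prime factors as \<open>n\<close>, so adding or
  subtracting it preserves coprimality to \<open>n\<close>.\<close>

lemma shift_coprime_square_dvd:
  assumes "p > 0" "p\<^sup>2 dvd n" "coprime a (int n)"
  shows "\<exists>d. of_int d = real n * (1 / real p) \<and> coprime (a + d) (int n) \<and> coprime (a - d) (int n)"
proof -
  obtain m where m: "n = p * (p * m)" using assms by (auto simp: power2_eq_square mult.assoc)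
  have "coprime a (int (p * m))" using assms m by simp
  then have "coprime (a + int (p * m)) (int (p * m))" "coprime (a - int (p * m)) (int (p * m))"
    by (simp_all add: coprime_iff_gcd_eq_1 gcd_diff1 del: of_nat_mult)
  then show ?thesis
    using assms(1) m by (intro exI[of _ "int (p * m)"]) auto
qed

section \<open>Full measure, large measure and the final case distinction\<close>

lemma inhom_approx_set_full:
  assumes pos: "\<not> negligible (inhom_approx_set \<psi> z)"
    and A: "\<And>p. prime p \<Longrightarrow> negligible (restricted_approx_set (\<lambda>n. \<not> p dvd n) \<psi> z)"
    and B: "\<And>p. prime p \<Longrightarrow> negligible (restricted_approx_set (\<lambda>n. p dvd n \<and> \<not> p\<^sup>2 dvd n) \<psi> z)"
  shows "AE x in lebesgue. x \<in> inhom_approx_set \<psi> z"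
proof -
  let ?E = "restricted_approx_set (\<lambda>_. True) \<psi> z"
  have ge: "unit_measure ?E \<ge> 1 - \<epsilon>" if eps: "\<epsilon> > 0" for \<epsilon>
  proof -
    obtain x e where "e > 0" and dens:
      "\<And>r. 0 < r \<Longrightarrow> r < e \<Longrightarrow> (1 - \<epsilon>) * measure lebesgue (cball x r) < measure lebesgue (?E \<inter> cball x r)"
      by (rule exists_density_point[OF lebesgue_restricted_approx_set pos[unfolded inhom_approx_set_eq] eps])
        (rule that)
    obtain N :: nat where N: "1 / e < real N" using reals_Archimedean2 by blast
    \<comment> \<open>The prime is chosen after the density point, so that one period
      \<open>1 / p\<close> fits into the dense scale; hence the hypotheses on all primes.\<close>
    obtain p where p: "prime p" "p > N" using bigger_prime by blast
    have p0: "p > 0" using p by (simp add: prime_gt_0_nat)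
    define r where "r = 1 / (2 * real p)"
    have "1 / e < real p" using N p by linarith
    then have r: "0 < r" "r < e" using p0 \<open>e > 0\<close> by (auto simp: r_def field_simps)
    let ?C = "restricted_approx_set (\<lambda>n. p\<^sup>2 dvd n) \<psi> z"
    let ?N = "restricted_approx_set (\<lambda>n. \<not> p dvd n) \<psi> z \<union>
      restricted_approx_set (\<lambda>n. p dvd n \<and> \<not> p\<^sup>2 dvd n) \<psi> z"
    have "?E = ?C \<union> ?N"
      unfolding restricted_approx_set_disj[symmetric] by (rule arg_cong[of _ _ "\<lambda>Q. restricted_approx_set Q \<psi> z"]) auto
    have N0: "negligible ?N" using A B p by simp
    have Cm: "?C \<inter> cball x r \<in> lmeasurable"
      by (intro fmeasurableI2[OF lmeasurable_cball[of x r]] sets.Int) auto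
    have "1 - \<epsilon> = real p * ((1 - \<epsilon>) * measure lebesgue (cball x r))"
      using p0 r(1) by (simp add: cball_eq_atLeastAtMost r_def)
    also have "\<dots> < real p * measure lebesgue (?E \<inter> cball x r)"
      using dens[OF r] p0 by simp
    also have "measure lebesgue (?E \<inter> cball x r) \<le> measure lebesgue ((?C \<inter> cball x r) \<union> ?N)"
    proof (rule measure_mono_fmeasurable)
      show "?E \<inter> cball x r \<subseteq> (?C \<inter> cball x r) \<union> ?N" using \<open>?E = _\<close> by blast
      show "?E \<inter> cball x r \<in> sets lebesgue" by (intro sets.Int) auto
      show "(?C \<inter> cball x r) \<union> ?N \<in> lmeasurable"
        using fmeasurable.Un[OF Cm negligible_imp_measurable[OF N0]] .
    qed
    also have "\<dots> \<le> measure lebesgue (?C \<inter> cball x r) + measure lebesgue ?N"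
      using Cm by (intro measure_Un_le) auto
    also have "measure lebesgue ?N = 0" using N0 by (rule negligible_imp_measure0)
    finally have "1 - \<epsilon> < real p * measure lebesgue (?C \<inter> cball x r)" using p0 by simp
    also have "\<dots> \<le> unit_measure ?C"
      unfolding r_def
      by (rule unit_measure_ge_cball)
        (use p0 shift_coprime_square_dvd in \<open>auto intro!: restricted_approx_set_shift simp del: times_divide_eq_right\<close>)
    also have "\<dots> \<le> unit_measure ?E"
    proof -
      have "?C - ?E = {}" using \<open>?E = _\<close> by blast
      then show ?thesis by (simp add: unit_measure_mono)
    qed
    finally show ?thesis by simp
  qed
  have "unit_measure ?E \<le> 1"
    using unit_measure_mono[of ?E UNIV] by (simp add: unit_measure_def)
  moreover have "unit_measure ?E \<ge> 1"
  proof (rule field_le_epsilon)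
    fix e :: real assume "0 < e"
    from ge[OF this] show "1 \<le> unit_measure ?E + e" by linarith
  qed
  ultimately show ?thesis
    unfolding inhom_approx_set_eq
    by (intro AE_if_unit_measure_eq_1) (simp_all add: restricted_approx_set_periodic)
qed

text \<open>An expanding map blows a small neighbourhood of a density point up to a full period.\<close>

lemma unit_measure_expanded_gt:
  assumes "p > 1" and lim: "(\<lambda>n. \<psi> n / real n) \<longlonglongrightarrow> 0"
    and step: "\<And>k n a. k \<ge> 1 \<Longrightarrow> Q n \<Longrightarrow> n \<ge> 1 \<Longrightarrow> coprime a (int n) \<Longrightarrow>
      \<exists>b. coprime b (int n) \<and> of_int b = real (p ^ k) * of_int a + real n * s"
    and pos: "\<not> negligible (restricted_approx_set Q \<psi> z)" and "\<epsilon> > 0"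
  obtains K where "\<And>k. k \<ge> K \<Longrightarrow> unit_measure (inhom_approx_set \<psi> (real (p ^ k) * z)) > 1 - \<epsilon>"
proof -
  let ?S = "restricted_approx_set Q \<psi> z"
  obtain x e where "e > 0" and dens:
    "\<And>r. 0 < r \<Longrightarrow> r < e \<Longrightarrow> (1 - \<epsilon>) * measure lebesgue (cball x r) < measure lebesgue (?S \<inter> cball x r)"
    by (rule exists_density_point[OF lebesgue_restricted_approx_set pos \<open>\<epsilon> > 0\<close>]) (rule that)
  have "(\<lambda>k. 1 / (2 * real (p ^ k))) \<longlonglongrightarrow> 0"
  proof -
    have "(\<lambda>k. 1 / 2 * (1 / real p) ^ k) \<longlonglongrightarrow> 1 / 2 * 0"
      using \<open>p > 1\<close> by (intro tendsto_mult tendsto_const LIMSEQ_power_zero) simp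
    then show ?thesis by (simp add: power_divide)
  qed
  then have "\<forall>\<^sub>F k in sequentially. 1 / (2 * real (p ^ k)) < e"
    using \<open>e > 0\<close> by (rule order_tendstoD)
  then have "\<forall>\<^sub>F k in sequentially. unit_measure (inhom_approx_set \<psi> (real (p ^ k) * z)) > 1 - \<epsilon>"
    using eventually_ge_at_top[of 1]
  proof eventually_elim
    case (elim k)
    define M where "M = p ^ k"
    have M: "M > 0" using \<open>p > 1\<close> by (simp add: M_def)
    \<comment> \<open>The expansion by \<open>M\<close> carries this ball to one of radius
      \<open>1 / 2\<close>, a full period.\<close>
    define r where "r = 1 / (2 * real M)"
    let ?T = "restricted_approx_set Q (\<lambda>n. real M * \<psi> n) (real M * z)"
    have r: "0 < r" "r < e" using M elim by (auto simp: r_def M_def)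
    have "1 - \<epsilon> = real M * ((1 - \<epsilon>) * measure lebesgue (cball x r))"
      using M r(1) by (simp add: cball_eq_atLeastAtMost r_def)
    also have "\<dots> < real M * measure lebesgue (?S \<inter> cball x r)"
      using dens[OF r] M by simp
    also have "\<dots> = measure lebesgue ((\<lambda>y. real M * y + s) ` (?S \<inter> cball x r))"
      by (simp add: measure_affine_image_real)
    also have "\<dots> \<le> measure lebesgue (?T \<inter> cball (real M * x + s) (1 / 2))"
    proof (rule measure_mono_fmeasurable)
      show "(\<lambda>y. real M * y + s) ` (?S \<inter> cball x r) \<subseteq> ?T \<inter> cball (real M * x + s) (1 / 2)"
      proof
        fix w assume "w \<in> (\<lambda>y. real M * y + s) ` (?S \<inter> cball x r)"
        then obtain v where "w = real M * v + s" "v \<in> ?S \<inter> cball x r" by (rule imageE)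
        then have v: "w = real M * v + s" "v \<in> ?S" "dist x v \<le> r" by simp_all
        have "dist (real M * x + s) w = real M * dist x v"
          using v(1) by (simp add: dist_real_def abs_mult flip: right_diff_distrib)
        also have "\<dots> \<le> real M * r" using v(3) by (intro mult_left_mono) auto
        also have "\<dots> = 1 / 2" using M by (simp add: r_def)
        finally show "w \<in> ?T \<inter> cball (real M * x + s) (1 / 2)"
          using restricted_approx_set_affine[OF M step[of k, folded M_def] v(2)] elim v(1) by simp
      qed
      have "?S \<inter> cball x r \<in> sets borel"
        by (simp add: restricted_approx_set_def borel_closed sets.Int)
      with M show "(\<lambda>y. real M * y + s) ` (?S \<inter> cball x r) \<in> sets lebesgue"
        by (intro lebesgue_affine_image_real) auto
      show "?T \<inter> cball (real M * x + s) (1 / 2) \<in> lmeasurable"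
        by (intro fmeasurableI2[OF lmeasurable_cball[of "real M * x + s" "1/2"]] sets.Int) auto
    qed
    also have "\<dots> \<le> unit_measure ?T"
      using unit_measure_ge_cball[of ?T 1 "real M * x + s"] by (simp add: restricted_approx_set_periodic)
    also have "\<dots> \<le> unit_measure (inhom_approx_set \<psi> (real M * z))"
      using M lim by (rule unit_measure_dilated_le)
    finally show ?case by (simp add: M_def)
  qed
  then show thesis using that unfolding eventually_sequentially by blast
qed

text \<open>The shift \<open>p ^ k * (m * y)\<close> belongs to the multiplier
  \<open>p ^ k * m\<close>, and different \<open>k\<close> give different multipliers.\<close>

lemma inhom_approx_set_large_shifts:
  assumes "m \<ge> 1" "p > 1" and lim: "(\<lambda>n. \<psi> n / real n) \<longlonglongrightarrow> 0"
    and step: "\<And>k n a. k \<ge> 1 \<Longrightarrow> Q n \<Longrightarrow> n \<ge> 1 \<Longrightarrow> coprime a (int n) \<Longrightarrow>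
      \<exists>b. coprime b (int n) \<and> of_int b = real (p ^ k) * of_int a + real n * s"
    and pos: "\<not> negligible (restricted_approx_set Q \<psi> (real m * y))" and "\<epsilon> > 0"
  shows "infinite {m::nat. m \<ge> 1 \<and> unit_measure (inhom_approx_set \<psi> (real m * y)) > 1 - \<epsilon>}"
proof -
  obtain K where K: "\<And>k. k \<ge> K \<Longrightarrow> unit_measure (inhom_approx_set \<psi> (real (p ^ k) * (real m * y))) > 1 - \<epsilon>"
    by (rule unit_measure_expanded_gt[OF \<open>p > 1\<close> lim step pos \<open>\<epsilon> > 0\<close>]) (assumption | rule that)+
  have "inj_on (\<lambda>k. p ^ k * m) {K..}"
    using assms(1,2) by (auto simp: inj_on_def power_inject_exp)
  then have "infinite ((\<lambda>k. p ^ k * m) ` {K..})"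
    using infinite_Ici finite_imageD by blast
  moreover have "(\<lambda>k. p ^ k * m) ` {K..} \<subseteq>
      {m. m \<ge> 1 \<and> unit_measure (inhom_approx_set \<psi> (real m * y)) > 1 - \<epsilon>}"
    using K assms(1,2) by (auto simp: mult.assoc Suc_le_eq)
  ultimately show ?thesis by (rule infinite_super[rotated])
qed

lemma inhom_approx_set_trichotomy:
  fixes y :: real and \<psi> :: "nat \<Rightarrow> real"
  assumes "\<And>n. n \<ge> 1 \<Longrightarrow> \<psi> n \<ge> 0"
  obtains (null) "\<And>m::nat. m \<ge> 1 \<Longrightarrow> unit_measure (inhom_approx_set \<psi> (real m * y)) = 0"
    | (full) m :: nat where "m \<ge> 1" "AE x in lebesgue. x \<in> inhom_approx_set \<psi> (real m * y)"
    | (large) "\<And>\<epsilon>::real. \<epsilon> > 0 \<Longrightarrow>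
        infinite {m::nat. m \<ge> 1 \<and> unit_measure (inhom_approx_set \<psi> (real m * y)) > 1 - \<epsilon>}"
proof (cases "(\<lambda>n. \<psi> n / real n) \<longlonglongrightarrow> 0")
  case False
  then obtain c where c: "c > 0" "\<not> (\<forall>\<^sub>F n in sequentially. dist (\<psi> n / real n) 0 < c)"
    by (auto simp: tendsto_iff)
  \<comment> \<open>Nonnegativity turns distance from 0 into a lower bound; index 0 is left out, as
    the sign of \<open>\<psi> 0\<close> is not known.\<close>
  have "\<exists>\<^sub>F n in sequentially. \<psi> n / real n \<ge> c"
    unfolding frequently_def
  proof
    assume "\<forall>\<^sub>F n in sequentially. \<not> c \<le> \<psi> n / real n"
    then have "\<forall>\<^sub>F n in sequentially. dist (\<psi> n / real n) 0 < c"
      using eventually_ge_at_top[of 1] by eventually_elim (use assms in auto)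
    with c(2) show False by contradiction
  qed
  then have "inhom_approx_set \<psi> (real 1 * y) = UNIV"
    using c(1) by (intro inhom_approx_set_eq_UNIV)
  then show thesis by (intro full[of 1]) simp_all
next
  case lim: True
  show thesis
  proof (cases "\<forall>m\<ge>1. unit_measure (inhom_approx_set \<psi> (real m * y)) = 0")
    case True
    then show thesis by (intro null) blast
  next
    case False
    then obtain m where m: "m \<ge> 1" "unit_measure (inhom_approx_set \<psi> (real m * y)) \<noteq> 0" by blast
    let ?z = "real m * y"
    have pos: "\<not> negligible (inhom_approx_set \<psi> ?z)"
    proof
      assume "negligible (inhom_approx_set \<psi> ?z)"
      then have "negligible (inhom_approx_set \<psi> ?z \<inter> {0..<1})" by (rule negligible_subset) simp
      from negligible_imp_measure0[OF this] show False using m(2) unfolding unit_measure_def by contradiction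
    qed
    show thesis
    \<comment> \<open>One prime with a nonnull first or second part yields \<open>large\<close>; if
      no prime has one, the set is full for this \<open>m\<close>.\<close>
    proof (cases "\<exists>p. prime p \<and> (\<not> negligible (restricted_approx_set (\<lambda>n. \<not> p dvd n) \<psi> ?z) \<or>
        \<not> negligible (restricted_approx_set (\<lambda>n. p dvd n \<and> \<not> p\<^sup>2 dvd n) \<psi> ?z))")
      case True
      then obtain p where p: "prime p" and
        pos: "\<not> negligible (restricted_approx_set (\<lambda>n. \<not> p dvd n) \<psi> ?z) \<or>
          \<not> negligible (restricted_approx_set (\<lambda>n. p dvd n \<and> \<not> p\<^sup>2 dvd n) \<psi> ?z)" by blast
      show thesis
      proof (rule large)
        fix \<epsilon> :: real assume eps: "\<epsilon> > 0"
        note large_shifts = inhom_approx_set_large_shifts[OF m(1) prime_gt_1_nat[OF p] lim]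
        from pos show "infinite {m::nat. m \<ge> 1 \<and> unit_measure (inhom_approx_set \<psi> (real m * y)) > 1 - \<epsilon>}"
        proof
          assume "\<not> negligible (restricted_approx_set (\<lambda>n. \<not> p dvd n) \<psi> ?z)"
          from large_shifts[OF expand_coprime_not_dvd[OF p] this eps] show ?thesis .
        next
          assume "\<not> negligible (restricted_approx_set (\<lambda>n. p dvd n \<and> \<not> p\<^sup>2 dvd n) \<psi> ?z)"
          from large_shifts[OF expand_coprime_exactly_dvd[OF p] this eps] show ?thesis by simp
        qed
      qed
    next
      case False
      then show thesis using inhom_approx_set_full[OF pos] m(1) by (intro full[of m]) blast+
    qed
  qed
qed

theorem theorem1p6:
  fixes y :: real and \<psi> :: "nat \<Rightarrow> real"
  assumes "\<And>n. n \<ge> 1 \<Longrightarrow> \<psi> n \<ge> 0"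
  shows "(\<forall>m::nat. m \<ge> 1 \<longrightarrow> unit_measure (inhom_approx_set \<psi> (real m * y)) = 0)
    \<or> (\<exists>m::nat. m \<ge> 1 \<and> (AE x in lebesgue. x \<in> inhom_approx_set \<psi> (real m * y)))
    \<or> (\<forall>\<epsilon>::real. \<epsilon> > 0 \<longrightarrow>
         infinite {m::nat. m \<ge> 1 \<and> unit_measure (inhom_approx_set \<psi> (real m * y)) > 1 - \<epsilon>})"
  by (rule inhom_approx_set_trichotomy[OF assms, where y = y]) blast+

end
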